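(* Let $\mathcal V=\{V_i\}_{i\in P}$ be a set of views that explains a strongly causal consistent execution. Let $\mathcal R=\{R_i\}_{i\in P}$ be any good record of $\mathcal V$ (in the data-race sense, RnR Model 2). Then for every process $i\in P$ and any two operations $o^1,o^2\in( *,i,*,* )\cup(\mathrm w,*,*,* )$: if $$(o^1,o^2)\in\widehat{A}_i(\mathcal V)\setminus\bigl(PO\cup SWO_i(\mathcal V)\cup B_i(\mathcal V)\bigr)$$ (plain set-theoretic union, $\widehat A_i(\mathcal V)$ the transitive reduction of $A_i(\mathcal V)$), then $(o^1,o^2)\in R_i$.
   Context: Relations are sets of ordered pairs; $a<_R b$ means $(a,b)\in R$, and $a\le_R b$ means $a<_R b$ or $a=b$. Partial and total orders are strict (irreflexive, antisymmetric, transitive). $A$ respects $B$ means $B\subseteq A$. $A\mid S$ is the restriction $A\cap(S\times S)$. $\widehat A$ is the (unique) transitive reduction of a partial order $A$ on a finite set. For relations $A,B$, write $A\sqcup B$ for the transitive closure of $A\cup B$, while $\cup$ is the plain union. System. There are a finite set $P$ of processes, a finite set $X$ of shared variables and a finite set $O$ of operations. Each operation is a read or a write, performed by one process on one variable. $( *,i,*,* )$ is the set of operations of process $i$, $( *,*,x,* )$ the set of operations on variable $x$, $(\mathrm w,*,*,* )$ the set of all writes, $(\mathrm w,i,*,* )$ the set of writes of process $i$. Put $D_i=( *,i,*,* )\cup(\mathrm w,*,*,* )$. For each $i$ a total order $PO(i)$ on $( *,i,*,* )$ is fixed (independent of the execution), and $PO=\bigcup_i PO(i)$ (program order). Writes write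 pairwise distinct values. Executions and views. An execution specifies for every read the value it returns: that of some write to the same variable, or the initial default value of the variable. For an execution, a view on $D_i$ is a total order on $D_i$ in which every read returns the value of the last preceding write to the same variable (the default value if there is none). Consequently every family of total orders on the sets $D_i$, $i\in P$, is a family of views for exactly one execution. The data-race order of a view $V$ is $DRO(V)=\bigcup_{x\in X}V\mid( *,*,x,* )$. Strong causal consistency. For $\mathcal V=\{V_i\}_{i\in P}$: for a write $w^1$ and a write $w^2$ of process $i$, $(w^1,w^2)\in SCO(\mathcal V)$ iff $(w^1,w^2)\in V_i$. $\mathcal V$ explains a strongly causal consistent execution if for every $i$, $V_i$ is a view on $D_i$ for that execution and $V_i$ respects $SCO(\mathcal V)$ and $PO\mid D_i$. Strong write order. For a write $w^1$ and a write $w^2$ of process $i$: $(w^1,w^2)\in SWO^1(\mathcal V)$ iff $(w^1,w^2)\in DRO(V_i)\sqcup(PO\mid D_i)$; for $k\ge2$, $(w^1,w^2)\in SWO^k(\mathcal V)$ iff $(w^1,w^2)\in DRO(V_i)\sqcup SWO^{k-1}(\mathcal V)\sqcup(PO\mid D_i)$. $SWO(\mathcal V)=\bigcup_{k\ge1}SWO^k(\mathcal V)$. $SWO_j(\mathcal V)$ is the set of $(w^1,w^2)\in SWO(\mathcal V)$ with $w^2$ a write of a process different from $j$. $A_i(\mathcal V)=DRO(V_i)\sqcup SWO_i(\mathcal V)\sqcup(PO\mid D_i)$. Relation $C_i$. For a process $i$, an operation $o^1$ and a write $w^2$, define relations $C_i^k=C_i^k(\mathcal V,o^1,w^2)$ on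 writes by: (1) for distinct writes $w^3$ and $w^4$ with $w^4\in(\mathrm w,i,*,* )$: $(w^3,w^4)\in C_i^1$ iff $o^1\le_{A_i(\mathcal V)}w^4$ and $w^3\le_{A_i(\mathcal V)}w^2$. (2) For $k\ge2$ and distinct writes $w^3$ and $w^4$, with $w^4$ a write of process $i'$: $(w^3,w^4)\in C_i^k$ iff there are writes $w^5,w^6$ with $(w^5,w^6)\in C_i^{k-1}$, $w^3\le_{A_{i'}(\mathcal V)\sqcup C_i^{k-1}}w^5$ and $w^6\le_{A_{i'}(\mathcal V)}w^4$. $C_i(\mathcal V,o^1,w^2)=\bigcup_{k\ge1}C_i^k(\mathcal V,o^1,w^2)$. Relation $B_i$. For an operation $o^1$ and a write $w^2$ on the same variable, $(o^1,w^2)\in B_i(\mathcal V)$ iff $(o^1,w^2)\in DRO(V_i)$ and there is a process $m\in P$ such that either $m\ne i$ and $A_m(\mathcal V)\cup C_i(\mathcal V,o^1,w^2)$ has a directed cycle, or $m=i$ and $\bigl(A_i(\mathcal V)\setminus\{(o^1,w^2)\}\bigr)\cup C_i(\mathcal V,o^1,w^2)$ has a directed cycle. Records (RnR Model 2). A record of $\mathcal V$ is a family $\mathcal R=\{R_i\}_{i\in P}$ with $R_i\subseteq DRO(V_i)$. A set of views $\mathcal V'$ certifies a replay to be valid for $\mathcal R$ if $\mathcal V'$ explains a strongly causal consistent execution and $R_i\subseteq V'_i$ for all $i$. $\mathcal R$ is good if every such $\mathcal V'$ has $DRO(V'_i)=DRO(V_i)$ for all $i\in P$. *)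

theory Defs
  imports Main
begin

section \<open>Relations\<close>

definition strict_total_order :: "'a set \<Rightarrow> 'a rel \<Rightarrow> bool" where
  "strict_total_order S r \<longleftrightarrow> r \<subseteq> S \<times> S \<and> strict_linear_order_on S r"

definition rle :: "'a rel \<Rightarrow> 'a \<Rightarrow> 'a \<Rightarrow> bool" where
  "rle r a b \<longleftrightarrow> (a, b) \<in> r \<or> a = b"

definition tjoin :: "'a rel \<Rightarrow> 'a rel \<Rightarrow> 'a rel" (infixl \<open>\<squnion>\<^sub>t\<close> 65) where
  "A \<squnion>\<^sub>t B = (A \<union> B)\<^sup>+"

text \<open>The minimal relation with transitive closure \<open>A\<close>. It is only meaningful when \<open>A\<close> is a
  finite strict partial order; \<open>transitive_reduction_eq_cover\<close> below shows that it then exists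
  and is unique.\<close>
definition transitive_reduction :: "'a rel \<Rightarrow> 'a rel" where
  "transitive_reduction A = (THE B. B\<^sup>+ = A \<and> (\<forall>B'. B' \<subset> B \<longrightarrow> B'\<^sup>+ \<noteq> A))"

lemma cover_trancl:
  fixes A :: "'a rel"
  assumes "finite A" "trans A" "irrefl A"
  shows "{(a, b) \<in> A. \<not> (\<exists>c. (a, c) \<in> A \<and> (c, b) \<in> A)}\<^sup>+ = A" (is "?C\<^sup>+ = A")
proof (rule subset_antisym)
  have "?C\<^sup>+ \<subseteq> A\<^sup>+"
    by (rule trancl_mono_subset) auto
  then show "?C\<^sup>+ \<subseteq> A"
    by (simp only: trancl_id[OF assms(2)])
  define I where "I a b = {d. (a, d) \<in> A \<and> (d, b) \<in> A}" for a b
  have fin: "finite (I a b)" for a b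
  proof (rule finite_subset)
    show "I a b \<subseteq> Range A" by (auto simp: I_def)
    show "finite (Range A)" by (rule finite_Range[OF assms(1)])
  qed
  have less1: "card (I a c) < card (I a b)" if "(a, c) \<in> A" "(c, b) \<in> A" for a b c
  proof (rule psubset_card_mono[OF fin], rule psubsetI)
    show "I a c \<subseteq> I a b"
      unfolding I_def using transD[OF assms(2) _ that(2)] by blast
    have "c \<in> I a b" "c \<notin> I a c"
      using that irreflD[OF assms(3)] by (simp_all add: I_def)
    then show "I a c \<noteq> I a b" by metis
  qed
  have less2: "card (I c b) < card (I a b)" if "(a, c) \<in> A" "(c, b) \<in> A" for a b c
  proof (rule psubset_card_mono[OF fin], rule psubsetI)
    show "I c b \<subseteq> I a b"
      unfolding I_def using transD[OF assms(2) that(1)] by blast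
    have "c \<in> I a b" "c \<notin> I c b"
      using that irreflD[OF assms(3)] by (simp_all add: I_def)
    then show "I c b \<noteq> I a b" by metis
  qed
  have "(a, b) \<in> ?C\<^sup>+" if "(a, b) \<in> A" for a b
    using that
  proof (induction "card (I a b)" arbitrary: a b rule: less_induct)
    case less
    show ?case
    proof (cases "\<exists>c. (a, c) \<in> A \<and> (c, b) \<in> A")
      case False
      have "(a, b) \<in> ?C" by (simp only: mem_Collect_eq case_prod_conv) (rule conjI[OF less.prems False])
      then show ?thesis by (rule r_into_trancl)
    next
      case True
      then obtain c where c: "(a, c) \<in> A" "(c, b) \<in> A" by (elim exE conjE)
      show ?thesis
        by (rule trancl_trans[OF less.hyps[OF less1[OF c] c(1)] less.hyps[OF less2[OF c] c(2)]])
    qed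
  qed
  then show "A \<subseteq> ?C\<^sup>+" by (rule subrelI)
qed

lemma cover_least:
  fixes A :: "'a rel"
  assumes "B\<^sup>+ = A"
  shows "{(a, b) \<in> A. \<not> (\<exists>c. (a, c) \<in> A \<and> (c, b) \<in> A)} \<subseteq> B"
proof clarify
  fix a b assume "(a, b) \<in> A" and n: "\<not> (\<exists>c. (a, c) \<in> A \<and> (c, b) \<in> A)"
  then have "(a, b) \<in> B\<^sup>+" using assms by simp
  then show "(a, b) \<in> B"
  proof cases
    case (step c)
    then show ?thesis using n assms by blast
  qed
qed

lemma transitive_reduction_eq_cover:
  fixes A :: "'a rel"
  assumes "finite A" "trans A" "irrefl A"
  shows "transitive_reduction A = {(a, b) \<in> A. \<not> (\<exists>c. (a, c) \<in> A \<and> (c, b) \<in> A)}"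
    (is "_ = ?C")
  unfolding transitive_reduction_def
proof (rule the_equality)
  show "?C\<^sup>+ = A \<and> (\<forall>B'. B' \<subset> ?C \<longrightarrow> B'\<^sup>+ \<noteq> A)"
  proof (intro conjI allI impI)
    show "?C\<^sup>+ = A" by (rule cover_trancl[OF assms])
    fix B' assume "B' \<subset> ?C"
    then show "B'\<^sup>+ \<noteq> A" using cover_least[of B' A] by (meson leD)
  qed
next
  fix B assume B: "B\<^sup>+ = A \<and> (\<forall>B'. B' \<subset> B \<longrightarrow> B'\<^sup>+ \<noteq> A)"
  have "?C \<subseteq> B" by (rule cover_least[OF conjunct1[OF B]])
  moreover have "\<not> ?C \<subset> B" using conjunct2[OF B, rule_format, of ?C] cover_trancl[OF assms] by argo
  ultimately show "B = ?C" by (simp only: psubset_eq) argo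
qed


section \<open>Shared memory systems\<close>

text \<open>\<open>wval w\<close> is the value written by the write \<open>w\<close> (irrelevant for reads), \<open>init x\<close> the initial
  value of the variable \<open>x\<close>, and \<open>po i\<close> the program order of process \<open>i\<close>. An operation of
  \<open>ops\<close> that is not a write is a read.\<close>
record ('p, 'x, 'o, 'v) memsys =
  procs :: "'p set"
  vars :: "'x set"
  ops :: "'o set"
  is_write :: "'o \<Rightarrow> bool"
  proc :: "'o \<Rightarrow> 'p"
  var :: "'o \<Rightarrow> 'x"
  wval :: "'o \<Rightarrow> 'v"
  init :: "'x \<Rightarrow> 'v"
  po :: "'p \<Rightarrow> 'o rel"

definition proc_ops :: "('p, 'x, 'o, 'v) memsys \<Rightarrow> 'p \<Rightarrow> 'o set" where
  "proc_ops S i = {a \<in> ops S. proc S a = i}"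

definition var_ops :: "('p, 'x, 'o, 'v) memsys \<Rightarrow> 'x \<Rightarrow> 'o set" where
  "var_ops S x = {a \<in> ops S. var S a = x}"

definition writes :: "('p, 'x, 'o, 'v) memsys \<Rightarrow> 'o set" where
  "writes S = {a \<in> ops S. is_write S a}"

definition reads :: "('p, 'x, 'o, 'v) memsys \<Rightarrow> 'o set" where
  "reads S = {a \<in> ops S. \<not> is_write S a}"

definition memory_system :: "('p, 'x, 'o, 'v) memsys \<Rightarrow> bool" where
  "memory_system S \<longleftrightarrow>
     finite (procs S) \<and> finite (vars S) \<and> finite (ops S) \<and>
     (\<forall>a \<in> ops S. proc S a \<in> procs S \<and> var S a \<in> vars S) \<and>
     inj_on (wval S) (writes S) \<and>
     (\<forall>i \<in> procs S. strict_total_order (proc_ops S i) (po S i))"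

definition view_dom :: "('p, 'x, 'o, 'v) memsys \<Rightarrow> 'p \<Rightarrow> 'o set" where
  "view_dom S i = proc_ops S i \<union> writes S"

definition PO :: "('p, 'x, 'o, 'v) memsys \<Rightarrow> 'o rel" where
  "PO S = (\<Union>i \<in> procs S. po S i)"


section \<open>Executions and views\<close>

text \<open>An execution maps each read to the value it returns; its values outside \<open>reads S\<close> are
  irrelevant.\<close>
definition is_execution :: "('p, 'x, 'o, 'v) memsys \<Rightarrow> ('o \<Rightarrow> 'v) \<Rightarrow> bool" where
  "is_execution S E \<longleftrightarrow>
     (\<forall>r \<in> reads S. E r = init S (var S r) \<or>
        (\<exists>w \<in> writes S. var S w = var S r \<and> E r = wval S w))"

definition preceding_writes ::
    "('p, 'x, 'o, 'v) memsys \<Rightarrow> 'o rel \<Rightarrow> 'o \<Rightarrow> 'o set" where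
  "preceding_writes S V r = {w \<in> writes S. var S w = var S r \<and> (w, r) \<in> V}"

definition is_view ::
    "('p, 'x, 'o, 'v) memsys \<Rightarrow> ('o \<Rightarrow> 'v) \<Rightarrow> 'p \<Rightarrow> 'o rel \<Rightarrow> bool" where
  "is_view S E i V \<longleftrightarrow>
     strict_total_order (view_dom S i) V \<and>
     (\<forall>r \<in> reads S \<inter> view_dom S i.
        (preceding_writes S V r = {} \<and> E r = init S (var S r)) \<or>
        (\<exists>w \<in> preceding_writes S V r.
           (\<forall>w' \<in> preceding_writes S V r. rle V w' w) \<and> E r = wval S w))"

definition DRO :: "('p, 'x, 'o, 'v) memsys \<Rightarrow> 'o rel \<Rightarrow> 'o rel" where
  "DRO S V = (\<Union>x \<in> vars S. Restr V (var_ops S x))"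


section \<open>Strong causal consistency\<close>

definition SCO :: "('p, 'x, 'o, 'v) memsys \<Rightarrow> ('p \<Rightarrow> 'o rel) \<Rightarrow> 'o rel" where
  "SCO S V = {(w1, w2). w1 \<in> writes S \<and> w2 \<in> writes S \<and> (w1, w2) \<in> V (proc S w2)}"

definition explains ::
    "('p, 'x, 'o, 'v) memsys \<Rightarrow> ('p \<Rightarrow> 'o rel) \<Rightarrow> ('o \<Rightarrow> 'v) \<Rightarrow> bool" where
  "explains S V E \<longleftrightarrow>
     (\<forall>i \<in> procs S. is_view S E i (V i) \<and> SCO S V \<subseteq> V i \<and> Restr (PO S) (view_dom S i) \<subseteq> V i)"

definition explains_scc_execution ::
    "('p, 'x, 'o, 'v) memsys \<Rightarrow> ('p \<Rightarrow> 'o rel) \<Rightarrow> bool" where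
  "explains_scc_execution S V \<longleftrightarrow> (\<exists>E. is_execution S E \<and> explains S V E)"


section \<open>Strong write order\<close>

text \<open>Levels are counted from 1; level 0 is a dummy.\<close>
fun SWO_level :: "('p, 'x, 'o, 'v) memsys \<Rightarrow> ('p \<Rightarrow> 'o rel) \<Rightarrow> nat \<Rightarrow> 'o rel" where
  "SWO_level S V 0 = {}"
| "SWO_level S V (Suc 0) =
     {(w1, w2). w1 \<in> writes S \<and> w2 \<in> writes S \<and>
        (w1, w2) \<in> DRO S (V (proc S w2)) \<squnion>\<^sub>t Restr (PO S) (view_dom S (proc S w2))}"
| "SWO_level S V (Suc (Suc k)) =
     {(w1, w2). w1 \<in> writes S \<and> w2 \<in> writes S \<and>
        (w1, w2) \<in> DRO S (V (proc S w2)) \<squnion>\<^sub>t SWO_level S V (Suc k)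
                     \<squnion>\<^sub>t Restr (PO S) (view_dom S (proc S w2))}"

definition SWO :: "('p, 'x, 'o, 'v) memsys \<Rightarrow> ('p \<Rightarrow> 'o rel) \<Rightarrow> 'o rel" where
  "SWO S V = (\<Union>k \<in> {1..}. SWO_level S V k)"

definition SWO_other :: "('p, 'x, 'o, 'v) memsys \<Rightarrow> ('p \<Rightarrow> 'o rel) \<Rightarrow> 'p \<Rightarrow> 'o rel" where
  "SWO_other S V j = {(w1, w2) \<in> SWO S V. proc S w2 \<noteq> j}"

definition A_rel :: "('p, 'x, 'o, 'v) memsys \<Rightarrow> ('p \<Rightarrow> 'o rel) \<Rightarrow> 'p \<Rightarrow> 'o rel" where
  "A_rel S V i = DRO S (V i) \<squnion>\<^sub>t SWO_other S V i \<squnion>\<^sub>t Restr (PO S) (view_dom S i)"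


section \<open>The relations \<open>C\<close> and \<open>B\<close>\<close>

text \<open>Again level 0 is a dummy.\<close>
fun C_level ::
    "('p, 'x, 'o, 'v) memsys \<Rightarrow> ('p \<Rightarrow> 'o rel) \<Rightarrow> 'p \<Rightarrow> 'o \<Rightarrow> 'o \<Rightarrow> nat \<Rightarrow> 'o rel" where
  "C_level S V i o1 w2 0 = {}"
| "C_level S V i o1 w2 (Suc 0) =
     {(w3, w4). w3 \<in> writes S \<and> w4 \<in> writes S \<and> w3 \<noteq> w4 \<and> proc S w4 = i \<and>
        rle (A_rel S V i) o1 w4 \<and> rle (A_rel S V i) w3 w2}"
| "C_level S V i o1 w2 (Suc (Suc k)) =
     {(w3, w4). w3 \<in> writes S \<and> w4 \<in> writes S \<and> w3 \<noteq> w4 \<and>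
        (\<exists>w5 \<in> writes S. \<exists>w6 \<in> writes S.
           (w5, w6) \<in> C_level S V i o1 w2 (Suc k) \<and>
           rle (A_rel S V (proc S w4) \<squnion>\<^sub>t C_level S V i o1 w2 (Suc k)) w3 w5 \<and>
           rle (A_rel S V (proc S w4)) w6 w4)}"

definition C_rel ::
    "('p, 'x, 'o, 'v) memsys \<Rightarrow> ('p \<Rightarrow> 'o rel) \<Rightarrow> 'p \<Rightarrow> 'o \<Rightarrow> 'o \<Rightarrow> 'o rel" where
  "C_rel S V i o1 w2 = (\<Union>k \<in> {1..}. C_level S V i o1 w2 k)"

definition B_rel :: "('p, 'x, 'o, 'v) memsys \<Rightarrow> ('p \<Rightarrow> 'o rel) \<Rightarrow> 'p \<Rightarrow> 'o rel" where
  "B_rel S V i =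
     {(o1, w2). o1 \<in> ops S \<and> w2 \<in> writes S \<and> var S o1 = var S w2 \<and> (o1, w2) \<in> DRO S (V i) \<and>
        (\<exists>m \<in> procs S.
           (m \<noteq> i \<and> \<not> acyclic (A_rel S V m \<union> C_rel S V i o1 w2)) \<or>
           (m = i \<and> \<not> acyclic ((A_rel S V i - {(o1, w2)}) \<union> C_rel S V i o1 w2)))}"


section \<open>Records\<close>

definition is_record ::
    "('p, 'x, 'o, 'v) memsys \<Rightarrow> ('p \<Rightarrow> 'o rel) \<Rightarrow> ('p \<Rightarrow> 'o rel) \<Rightarrow> bool" where
  "is_record S V R \<longleftrightarrow> (\<forall>i \<in> procs S. R i \<subseteq> DRO S (V i))"

definition certifies_replay ::
    "('p, 'x, 'o, 'v) memsys \<Rightarrow> ('p \<Rightarrow> 'o rel) \<Rightarrow> ('p \<Rightarrow> 'o rel) \<Rightarrow> bool" where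
  "certifies_replay S V' R \<longleftrightarrow> explains_scc_execution S V' \<and> (\<forall>i \<in> procs S. R i \<subseteq> V' i)"

definition good_record ::
    "('p, 'x, 'o, 'v) memsys \<Rightarrow> ('p \<Rightarrow> 'o rel) \<Rightarrow> ('p \<Rightarrow> 'o rel) \<Rightarrow> bool" where
  "good_record S V R \<longleftrightarrow> is_record S V R \<and>
     (\<forall>V'. certifies_replay S V' R \<longrightarrow> (\<forall>i \<in> procs S. DRO S (V' i) = DRO S (V i)))"

end

theory Submission
  imports Defs
begin

text \<open>
  Suppose \<open>(o1, o2)\<close> is not recorded. Reverse this pair in \<open>A\<^sub>i\<close> and add to all the orders \<open>A\<^sub>m\<close>
  the relation \<open>C\<close> of write pairs that strong causality forces as a consequence. Every partial
  order on \<open>D\<^sub>m\<close> containing program order has a linear extension in which an operation of process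
  \<open>m\<close> is preceded only by its predecessors in the partial order. Hence such extensions of the
  modified orders create no further strong causal order, and they form a valid replay with a
  different data-race order. The modified orders are acyclic because \<open>(o1, o2)\<close> is a covering pair
  outside \<open>B\<^sub>i\<close>. If \<open>o2\<close> belongs to process \<open>i\<close>, the reversal forces nothing new and \<open>C = {}\<close>
  works (the relation \<open>C\<^sub>i\<close> itself would not, as it may contain \<open>(o1, o2)\<close>); otherwise \<open>C = C\<^sub>i\<close>.
\<close>

section \<open>Relations and linear extensions\<close>

lemma rle_iff_rtrancl: "trans r \<Longrightarrow> rle r a b \<longleftrightarrow> (a, b) \<in> r\<^sup>*"
  unfolding rle_def rtrancl_eq_or_trancl by (auto simp: trancl_id)

lemma rle_trancl_iff: "rle (r\<^sup>+) a b \<longleftrightarrow> (a, b) \<in> r\<^sup>*"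
  unfolding rle_def rtrancl_eq_or_trancl by auto

lemma tjoin3: "A \<squnion>\<^sub>t B \<squnion>\<^sub>t C = (A \<union> B \<union> C)\<^sup>+"
proof
  have "(A \<union> B)\<^sup>+ \<union> C \<subseteq> (A \<union> B \<union> C)\<^sup>+"
    using trancl_mono_subset[of "A \<union> B" "A \<union> B \<union> C"] by auto
  then have "((A \<union> B)\<^sup>+ \<union> C)\<^sup>+ \<subseteq> ((A \<union> B \<union> C)\<^sup>+)\<^sup>+"
    by (rule trancl_mono_subset)
  then show "A \<squnion>\<^sub>t B \<squnion>\<^sub>t C \<subseteq> (A \<union> B \<union> C)\<^sup>+"
    by (simp add: tjoin_def)
  show "(A \<union> B \<union> C)\<^sup>+ \<subseteq> A \<squnion>\<^sub>t B \<squnion>\<^sub>t C"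
    unfolding tjoin_def by (rule trancl_mono_subset) auto
qed

text \<open>A finite path meets only finitely many members of the chain, so the one with the largest
  index already carries it. Paths over all levels of a recursion thus become paths over a single
  level.\<close>

lemma rtrancl_Un_chain:
  fixes F :: "nat \<Rightarrow> 'a rel"
  assumes "mono F" and "(x, y) \<in> (B \<union> (\<Union>k. F k))\<^sup>*"
  shows "\<exists>k. (x, y) \<in> (B \<union> F k)\<^sup>*"
  using assms(2)
proof (induction rule: rtrancl_induct)
  case (step y z)
  then obtain k where k: "(x, y) \<in> (B \<union> F k)\<^sup>*" by blast
  from step(2) obtain l where l: "(y, z) \<in> B \<union> F l" by blast
  have "B \<union> F k \<subseteq> B \<union> F (max k l)" "B \<union> F l \<subseteq> B \<union> F (max k l)"
    using monoD[OF assms(1)] by (meson max.cobounded1 max.cobounded2 Un_mono order_refl)+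
  then have "(x, y) \<in> (B \<union> F (max k l))\<^sup>*" "(y, z) \<in> B \<union> F (max k l)"
    using k l rtrancl_mono by blast+
  then show ?case by (meson rtrancl.rtrancl_into_rtrancl)
qed auto

lemma trancl_Un_chain:
  fixes F :: "nat \<Rightarrow> 'a rel"
  assumes "mono F" and "(x, y) \<in> (B \<union> (\<Union>k. F k))\<^sup>+"
  shows "\<exists>k. (x, y) \<in> (B \<union> F k)\<^sup>+"
proof -
  from assms(2) obtain z l where z: "(x, z) \<in> (B \<union> (\<Union>k. F k))\<^sup>*" and l: "(z, y) \<in> B \<union> F l"
    by (blast dest: tranclD2)
  from rtrancl_Un_chain[OF assms(1) z] obtain k where k: "(x, z) \<in> (B \<union> F k)\<^sup>*" by blast
  have "B \<union> F k \<subseteq> B \<union> F (max k l)" "B \<union> F l \<subseteq> B \<union> F (max k l)"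
    using monoD[OF assms(1)] by (meson max.cobounded1 max.cobounded2 Un_mono order_refl)+
  then have "(x, z) \<in> (B \<union> F (max k l))\<^sup>*" "(z, y) \<in> B \<union> F (max k l)"
    using k l rtrancl_mono by blast+
  then show ?thesis by (meson rtrancl_into_trancl1)
qed

text \<open>Splitting at the last \<open>C\<close> step leaves a pure \<open>A\<close> tail, along
  which facts about targets of \<open>C\<close> can be carried to \<open>y\<close>.\<close>

lemma rtrancl_Un_last:
  assumes "(x, y) \<in> (A \<union> C)\<^sup>*"
  obtains "(x, y) \<in> A\<^sup>*"
  | u v where "(x, u) \<in> (A \<union> C)\<^sup>*" "(u, v) \<in> C" "(v, y) \<in> A\<^sup>*"
proof -
  have "(x, y) \<in> A\<^sup>* \<or> (\<exists>u v. (x, u) \<in> (A \<union> C)\<^sup>* \<and> (u, v) \<in> C \<and> (v, y) \<in> A\<^sup>*)"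
    using assms
  proof (induction rule: rtrancl_induct)
    case (step y z)
    then show ?case by (meson UnE rtrancl.rtrancl_refl rtrancl.rtrancl_into_rtrancl)
  qed auto
  then show thesis using that by blast
qed

text \<open>The last step \<open>(c, b)\<close> of such a path has \<open>c\<close> different from
  \<open>a\<close>, so \<open>c\<close> would lie strictly between \<open>a\<close> and
  \<open>b\<close>.\<close>

lemma cover_no_other_path:
  assumes "trans A" "irrefl A" "(a, b) \<in> A" "\<not> (\<exists>c. (a, c) \<in> A \<and> (c, b) \<in> A)"
  shows "(a, b) \<notin> (A - {(a, b)})\<^sup>*"
proof
  assume "(a, b) \<in> (A - {(a, b)})\<^sup>*"
  moreover have "a \<noteq> b" using assms(2,3) by (auto simp: irrefl_def)
  ultimately obtain c where c: "(a, c) \<in> (A - {(a, b)})\<^sup>*" "(c, b) \<in> A - {(a, b)}"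
    by (meson rtranclE)
  have "(a, c) \<in> A\<^sup>*" using c(1) rtrancl_mono[of "A - {(a, b)}" A] by blast
  then have "rle A a c" by (simp add: rle_iff_rtrancl[OF assms(1)])
  then show False using c(2) assms(4) unfolding rle_def by auto
qed

text \<open>The order is the lexicographic one on triples: the number of elements of the chain that
  are not above \<open>x\<close>, then the number of predecessors of \<open>x\<close>, then an arbitrary injective
  numbering.\<close>
lemma linear_extension_least_below_chain:
  assumes fin: "finite D" and A: "A \<subseteq> D \<times> D" "trans A" "irrefl A"
    and K: "K \<subseteq> D" "total_on K A"
  obtains L where "strict_total_order D L" "A \<subseteq> L"
    "\<And>x k. k \<in> K \<Longrightarrow> (x, k) \<in> L \<Longrightarrow> (x, k) \<in> A"
proof -
  obtain h :: "'a \<Rightarrow> nat" where h: "inj_on h D"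
    using finite_imp_inj_to_nat_seg[OF fin] by blast
  define r where "r x = card {k \<in> K. \<not> rle A x k}" for x
  define f where "f x = card {y. (y, x) \<in> A}" for x
  define key where "key x = (r x, f x, h x)" for x
  define lx where "lx = less_than <*lex*> less_than <*lex*> less_than"
  define L where "L = inv_image lx key \<inter> D \<times> D"
  have finK: "finite K" using K(1) fin finite_subset by blast
  have r_le: "r x \<le> r y" if "(x, y) \<in> A" for x y
    unfolding r_def using finK that transD[OF A(2)]
    by (intro card_mono) (auto simp: rle_def)
  have f_less: "f x < f y" if "(x, y) \<in> A" for x y
    unfolding f_def
  proof (rule psubset_card_mono)
    show "finite {u. (u, y) \<in> A}"
      by (rule finite_subset[OF _ fin]) (use A(1) in auto)
    show "{u. (u, x) \<in> A} \<subset> {u. (u, y) \<in> A}"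
      using that transD[OF A(2)] A(3) by (auto simp: irrefl_def)
  qed
  have r_less: "r k < r x" if "k \<in> K" "\<not> rle A x k" for x k
    unfolding r_def
  proof (rule psubset_card_mono)
    \<comment> \<open>An element of the chain \<open>K\<close> above \<open>x\<close> cannot lie
      below \<open>k\<close>, since then \<open>x\<close> would lie below \<open>k\<close> as well.
      The inclusion is strict because \<open>k\<close> itself is counted for \<open>x\<close>
      only.\<close>
    have "rle A k k'" if "k' \<in> K" "rle A x k'" for k'
      using \<open>\<not> rle A x k\<close> that \<open>k \<in> K\<close> K(2) transD[OF A(2)]
      unfolding rle_def total_on_def by metis
    then show "{l \<in> K. \<not> rle A k l} \<subset> {l \<in> K. \<not> rle A x l}"
      using that by (auto simp: rle_def)
  qed (use finK in auto)
  have tl: "trans lx" "irrefl lx" "total lx"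
    unfolding lx_def by (auto intro!: trans_lex_prod total_lex_prod simp: irrefl_def)
  show thesis
  proof
    have "trans L"
      using transD[OF tl(1)] unfolding L_def trans_def inv_image_def by blast
    moreover have "irrefl L"
      by (rule irreflI) (simp add: L_def irreflD[OF tl(2)])
    moreover have "total_on D L"
    proof (rule total_onI)
      fix x y assume xy: "x \<in> D" "y \<in> D" "x \<noteq> y"
      then have "key x \<noteq> key y" using h by (auto simp: key_def inj_on_def)
      then have "(key x, key y) \<in> lx \<or> (key y, key x) \<in> lx"
        using tl(3) unfolding total_on_def by blast
      then show "(x, y) \<in> L \<or> (y, x) \<in> L" using xy by (simp add: L_def)
    qed
    ultimately show "strict_total_order D L"
      unfolding strict_total_order_def strict_linear_order_on_def by (auto simp: L_def)
    \<comment> \<open>Along \<open>A\<close> the first component never decreases and the second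
      strictly increases, so the numbering \<open>h\<close> is not consulted.\<close>
    show "A \<subseteq> L"
      using A(1) r_le f_less by (fastforce simp: L_def lx_def key_def)
    show "(x, k) \<in> A" if "k \<in> K" "(x, k) \<in> L" for x k
    proof (rule ccontr)
      assume n: "(x, k) \<notin> A"
      have "(key x, key k) \<in> lx" using that(2) by (simp add: L_def)
      then have "x \<noteq> k" using irreflD[OF tl(2)] by metis
      \<comment> \<open>The first component alone puts \<open>x\<close> after
        \<open>k\<close>.\<close>
      then have "r k < r x" using n r_less[OF that(1)] by (auto simp: rle_def)
      then show False using that(2) by (auto simp: L_def lx_def key_def)
    qed
  qed
qed


section \<open>From causally closed partial orders to replays\<close>

lemma finite_view_dom: "memory_system S \<Longrightarrow> finite (view_dom S i)"
  by (auto simp: memory_system_def view_dom_def proc_ops_def writes_def)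

lemma strict_total_order_has_max:
  assumes "strict_total_order D L" "finite W" "W \<noteq> {}" "W \<subseteq> D"
  shows "\<exists>w \<in> W. \<forall>w' \<in> W. rle L w' w"
  using assms(2-4)
proof (induction rule: finite_ne_induct)
  case (insert x F)
  then obtain w where w: "w \<in> F" "\<forall>w' \<in> F. rle L w' w" by auto
  have L: "trans L" "total_on D L"
    using assms(1) by (auto simp: strict_total_order_def strict_linear_order_on_def)
  have "x \<noteq> w \<longrightarrow> (x, w) \<in> L \<or> (w, x) \<in> L"
    using L(2) insert.prems w(1) unfolding total_on_def by blast
  then show ?case
    using w transD[OF L(1)] unfolding rle_def by (metis insertE insertI1 insertI2)
qed (simp add: rle_def)

text \<open>A read lies in the view domain of its own process only, so its value can be taken from
  that one order without conflict.\<close>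

lemma total_orders_are_views:
  assumes S: "memory_system S"
    and V: "\<And>i. i \<in> procs S \<Longrightarrow> strict_total_order (view_dom S i) (V i)"
  obtains E where "is_execution S E" "\<And>i. i \<in> procs S \<Longrightarrow> is_view S E i (V i)"
proof -
  define last where "last V r w \<longleftrightarrow> w \<in> preceding_writes S V r \<and>
    (\<forall>w' \<in> preceding_writes S V r. rle V w' w)" for V r w
  define E where "E r = (if preceding_writes S (V (proc S r)) r = {} then init S (var S r)
    else wval S (SOME w. last (V (proc S r)) r w))" for r
  have last_some: "last (V (proc S r)) r (SOME w. last (V (proc S r)) r w)"
    if "r \<in> ops S" "preceding_writes S (V (proc S r)) r \<noteq> {}" for r
  proof (rule someI_ex)
    have p: "proc S r \<in> procs S" using S that(1) by (auto simp: memory_system_def)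
    have "preceding_writes S (V (proc S r)) r \<subseteq> view_dom S (proc S r)"
      by (auto simp: preceding_writes_def view_dom_def)
    then show "\<exists>w. last (V (proc S r)) r w"
      using strict_total_order_has_max[OF V[OF p] _ that(2)] finite_view_dom[OF S]
      unfolding last_def by (meson finite_subset)
  qed
  show thesis
  proof
    show "is_execution S E"
      unfolding is_execution_def
    proof
      fix r assume r: "r \<in> reads S"
      show "E r = init S (var S r) \<or> (\<exists>w \<in> writes S. var S w = var S r \<and> E r = wval S w)"
      proof (cases "preceding_writes S (V (proc S r)) r = {}")
        case False
        then show ?thesis
          using last_some[of r] r unfolding E_def last_def reads_def preceding_writes_def by auto
      qed (simp add: E_def)
    qed
    show "is_view S E i (V i)" if "i \<in> procs S" for i
      unfolding is_view_def
    proof (intro conjI ballI)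
      fix r assume r: "r \<in> reads S \<inter> view_dom S i"
      then have p: "proc S r = i" "r \<in> ops S"
        by (auto simp: reads_def view_dom_def proc_ops_def writes_def)
      show "preceding_writes S (V i) r = {} \<and> E r = init S (var S r) \<or>
        (\<exists>w \<in> preceding_writes S (V i) r.
           (\<forall>w' \<in> preceding_writes S (V i) r. rle (V i) w' w) \<and> E r = wval S w)"
        using last_some[OF p(2)] p(1) unfolding E_def last_def by auto
    qed (rule V[OF that])
  qed
qed

text \<open>By \<open>cl\<close>, the strong causality induced by the orders \<open>A j\<close> is
  contained in all of them. This survives linearisation if no extension creates a pair whose target
  belongs to its own process.\<close>

lemma replay_of_closed_orders:
  assumes S: "memory_system S"
    and dom: "\<And>j. j \<in> procs S \<Longrightarrow> A j \<subseteq> view_dom S j \<times> view_dom S j"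
    and tr: "\<And>j. j \<in> procs S \<Longrightarrow> trans (A j)"
    and irr: "\<And>j. j \<in> procs S \<Longrightarrow> irrefl (A j)"
    and po: "\<And>j. j \<in> procs S \<Longrightarrow> Restr (PO S) (view_dom S j) \<subseteq> A j"
    and cl: "SCO S A \<subseteq> (\<Inter>j \<in> procs S. A j)"
  obtains V where "explains_scc_execution S V" "\<And>j. j \<in> procs S \<Longrightarrow> A j \<subseteq> V j"
proof -
  have "\<exists>L. strict_total_order (view_dom S j) L \<and> A j \<subseteq> L \<and>
     (\<forall>x. \<forall>k \<in> proc_ops S j. (x, k) \<in> L \<longrightarrow> (x, k) \<in> A j)" if j: "j \<in> procs S" for j
  proof -
    have K: "proc_ops S j \<subseteq> view_dom S j" by (auto simp: view_dom_def)
    have "strict_total_order (proc_ops S j) (po S j)" using S j by (auto simp: memory_system_def)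
    then have "total_on (proc_ops S j) (po S j)" "po S j \<subseteq> Restr (PO S) (view_dom S j)"
      using j K by (auto simp: strict_total_order_def strict_linear_order_on_def PO_def)
    \<comment> \<open>Program order makes the operations of \<open>j\<close> a chain, which serves
      as \<open>K\<close> in the extension lemma.\<close>
    then have "total_on (proc_ops S j) (A j)"
      using po[OF j] unfolding total_on_def by blast
    from linear_extension_least_below_chain[OF finite_view_dom[OF S] dom[OF j] tr[OF j] irr[OF j] K this]
    show ?thesis by metis
  qed
  then obtain V where V: "\<And>j. j \<in> procs S \<Longrightarrow> strict_total_order (view_dom S j) (V j)"
      "\<And>j. j \<in> procs S \<Longrightarrow> A j \<subseteq> V j"
      "\<And>j x k. j \<in> procs S \<Longrightarrow> k \<in> proc_ops S j \<Longrightarrow> (x, k) \<in> V j \<Longrightarrow> (x, k) \<in> A j"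
    by metis
  obtain E where E: "is_execution S E" "\<And>i. i \<in> procs S \<Longrightarrow> is_view S E i (V i)"
    using total_orders_are_views[OF S V(1)] by metis
  \<comment> \<open>\<open>SCO\<close> consults a view only for targets of its own process, exactly
    where the extension has added nothing.\<close>
  have "SCO S V \<subseteq> SCO S A"
    using V(3) S by (auto simp: SCO_def writes_def proc_ops_def memory_system_def)
  then have "explains S V E"
    unfolding explains_def using E(2) cl V(2) po by blast
  then show thesis
    using that V(2) E(1) unfolding explains_scc_execution_def by blast
qed


section \<open>Strong write order\<close>

text \<open>As level 0 is empty, one equation covers level 1 and all later levels, and inductions
  can start at 0.\<close>

lemma SWO_level_Suc:
  "SWO_level S V (Suc k) = {(w1, w2). w1 \<in> writes S \<and> w2 \<in> writes S \<and>
     (w1, w2) \<in> (DRO S (V (proc S w2)) \<union> Restr (PO S) (view_dom S (proc S w2))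
        \<union> SWO_level S V k)\<^sup>+}"
proof (cases k)
  case 0
  then show ?thesis by (simp add: tjoin_def)
next
  case (Suc n)
  then show ?thesis by (simp only: SWO_level.simps tjoin3 Un_ac)
qed

lemma mono_SWO_level: "mono (SWO_level S V)"
proof (rule mono_iff_le_Suc[THEN iffD2], rule allI)
  fix n show "SWO_level S V n \<subseteq> SWO_level S V (Suc n)"
  proof (induction n)
    case (Suc n)
    have "(B \<union> SWO_level S V n)\<^sup>+ \<subseteq> (B \<union> SWO_level S V (Suc n))\<^sup>+" for B
      using Suc by (intro trancl_mono_subset) auto
    then show ?case unfolding SWO_level_Suc[of S V n] SWO_level_Suc[of S V "Suc n"] by blast
  qed simp
qed

lemma UN_atLeast_1:
  fixes F :: "nat \<Rightarrow> 'a set"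
  assumes "F 0 = {}"
  shows "(\<Union>k \<in> {1..}. F k) = (\<Union>k. F k)"
proof
  show "(\<Union>k. F k) \<subseteq> (\<Union>k \<in> {1..}. F k)"
  proof
    fix x assume "x \<in> (\<Union>k. F k)"
    then obtain k where k: "x \<in> F k" by blast
    then have "k \<in> {1..}" using assms by (cases k) auto
    with k show "x \<in> (\<Union>k \<in> {1..}. F k)" by blast
  qed
qed blast

lemma SWO_eq_UN: "SWO S V = (\<Union>k. SWO_level S V k)"
  unfolding SWO_def by (rule UN_atLeast_1) simp

section \<open>The orders \<open>A_rel\<close> and strong write order as a fixed point\<close>

lemma trans_A_rel: "trans (A_rel S V m)"
  unfolding A_rel_def tjoin_def by simp

lemma A_rel_eq: "A_rel S V m =
    (DRO S (V m) \<union> SWO_other S V m \<union> Restr (PO S) (view_dom S m))\<^sup>+"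
  unfolding A_rel_def by (rule tjoin3)

lemma A_rel_supersets:
  shows DRO_subset_A_rel: "DRO S (V m) \<subseteq> A_rel S V m"
    and SWO_other_subset_A_rel: "SWO_other S V m \<subseteq> A_rel S V m"
    and PO_subset_A_rel: "Restr (PO S) (view_dom S m) \<subseteq> A_rel S V m"
  unfolding A_rel_eq by auto

lemma SWO_subset_writes: "SWO S V \<subseteq> writes S \<times> writes S"
  unfolding SWO_eq_UN
proof (rule UN_least)
  fix k show "SWO_level S V k \<subseteq> writes S \<times> writes S"
    by (cases k) (auto simp: SWO_level_Suc)
qed

text \<open>Pairs with a target in \<open>m\<close> are not among the generators of
  \<open>A_rel S V m\<close>. By definition they arise from a path of data-race, program order and
  lower-level pairs, which lies in \<open>A_rel S V m\<close> by induction.\<close>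

lemma SWO_subset_A_rel: "SWO S V \<subseteq> A_rel S V m"
  unfolding SWO_eq_UN
proof (rule UN_least)
  fix k show "SWO_level S V k \<subseteq> A_rel S V m"
  proof (induction k)
    case (Suc k)
    show ?case
    proof (rule subrelI)
      fix w1 w2 assume w: "(w1, w2) \<in> SWO_level S V (Suc k)"
      show "(w1, w2) \<in> A_rel S V m"
      proof (cases "proc S w2 = m")
        case True
        then have "(w1, w2) \<in> (DRO S (V m) \<union> Restr (PO S) (view_dom S m) \<union> SWO_level S V k)\<^sup>+"
          using w by (simp add: SWO_level_Suc)
        moreover have "\<dots> \<subseteq> (A_rel S V m)\<^sup>+"
          using Suc A_rel_supersets[where S = S and V = V and m = m] by (intro trancl_mono_subset) blast
        ultimately show ?thesis by (metis subsetD trancl_id[OF trans_A_rel])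
      next
        case False
        then have "(w1, w2) \<in> SWO_other S V m"
          using w unfolding SWO_other_def SWO_eq_UN by blast
        then show ?thesis by (rule subsetD[OF SWO_other_subset_A_rel])
      qed
    qed
  qed simp
qed

text \<open>The fixed point of the level recursion. For the converse, a path in \<open>A_rel\<close>
  uses pairs of a single level only, so its end points are related one level higher.\<close>

lemma SWO_iff:
  "(w1, w2) \<in> SWO S V \<longleftrightarrow> w1 \<in> writes S \<and> w2 \<in> writes S \<and> (w1, w2) \<in> A_rel S V (proc S w2)"
proof
  assume "(w1, w2) \<in> SWO S V"
  then show "w1 \<in> writes S \<and> w2 \<in> writes S \<and> (w1, w2) \<in> A_rel S V (proc S w2)"
    using SWO_subset_writes[of S V] SWO_subset_A_rel[of S V] by blast
next
  assume w: "w1 \<in> writes S \<and> w2 \<in> writes S \<and> (w1, w2) \<in> A_rel S V (proc S w2)"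
  let ?B = "DRO S (V (proc S w2)) \<union> Restr (PO S) (view_dom S (proc S w2))"
  have "A_rel S V (proc S w2) \<subseteq> (?B \<union> (\<Union>k. SWO_level S V k))\<^sup>+"
    unfolding A_rel_eq SWO_other_def SWO_eq_UN by (intro trancl_mono_subset) auto
  then have "(w1, w2) \<in> (?B \<union> (\<Union>k. SWO_level S V k))\<^sup>+" using w by (meson subsetD)
  from trancl_Un_chain[OF mono_SWO_level this]
  obtain k where "(w1, w2) \<in> (?B \<union> SWO_level S V k)\<^sup>+" by blast
  then have "(w1, w2) \<in> SWO_level S V (Suc k)"
    unfolding SWO_level_Suc using w by auto
  then show "(w1, w2) \<in> SWO S V" unfolding SWO_eq_UN by blast
qed

text \<open>Both pairs lie in the order of the process of the last write, since every
  \<open>A_rel\<close> contains all of \<open>SWO\<close>.\<close>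

lemma trans_SWO: "trans (SWO S V)"
proof (rule transI)
  fix x y z assume xy: "(x, y) \<in> SWO S V" and yz: "(y, z) \<in> SWO S V"
  then have "(x, y) \<in> A_rel S V (proc S z)" "(y, z) \<in> A_rel S V (proc S z)"
    using SWO_subset_A_rel[of S V "proc S z"] by blast+
  then have "(x, z) \<in> A_rel S V (proc S z)" by (rule transD[OF trans_A_rel])
  then show "(x, z) \<in> SWO S V" using xy yz by (simp add: SWO_iff)
qed

text \<open>The view of the target's process is transitive and contains all ingredients of the next
  level: its data-race order, program order and, by strong causality, the lower level.\<close>

lemma SWO_subset_SCO:
  assumes S: "memory_system S" and V: "explains_scc_execution S V"
  shows "SWO S V \<subseteq> SCO S V"
  unfolding SWO_eq_UN
proof (rule UN_least)
  fix k show "SWO_level S V k \<subseteq> SCO S V"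
  proof (induction k)
    case (Suc k)
    show ?case
    proof (rule subrelI)
      fix w1 w2 assume w: "(w1, w2) \<in> SWO_level S V (Suc k)"
      then have ww: "w1 \<in> writes S" "w2 \<in> writes S" unfolding SWO_level_Suc by auto
      define m where "m = proc S w2"
      have "m \<in> procs S" using ww(2) S by (auto simp: m_def writes_def memory_system_def)
      then have m: "trans (V m)" "SCO S V \<subseteq> V m" "Restr (PO S) (view_dom S m) \<subseteq> V m"
        using V by (auto simp: explains_scc_execution_def explains_def is_view_def
            strict_total_order_def strict_linear_order_on_def)
      have "(DRO S (V m) \<union> Restr (PO S) (view_dom S m) \<union> SWO_level S V k)\<^sup>+ \<subseteq> (V m)\<^sup>+"
        using m Suc by (intro trancl_mono_subset) (auto simp: DRO_def)
      then have "(w1, w2) \<in> V m"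
        using w m(1) unfolding SWO_level_Suc m_def by auto
      then show "(w1, w2) \<in> SCO S V" using ww by (simp add: SCO_def m_def)
    qed
  qed simp
qed

text \<open>Through this inclusion \<open>A_rel\<close> inherits irreflexivity and the domain from
  the view.\<close>

lemma A_rel_subset_view:
  assumes S: "memory_system S" and V: "explains_scc_execution S V" and m: "m \<in> procs S"
  shows "A_rel S V m \<subseteq> V m"
proof -
  have "trans (V m)" "SCO S V \<subseteq> V m" "Restr (PO S) (view_dom S m) \<subseteq> V m"
    using V m by (auto simp: explains_scc_execution_def explains_def is_view_def
        strict_total_order_def strict_linear_order_on_def)
  then have "A_rel S V m \<subseteq> (V m)\<^sup>+"
    unfolding A_rel_eq using SWO_subset_SCO[OF S V]
    by (intro trancl_mono_subset) (auto simp: DRO_def SWO_other_def)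
  then show ?thesis using \<open>trans (V m)\<close> by simp
qed


section \<open>The relation \<open>C\<close>\<close>

text \<open>The recursive clause with \<open>w5 = w3\<close> and \<open>w6 = w4\<close> keeps every
  pair, as \<open>rle\<close> is reflexive.\<close>

lemma mono_C_level: "mono (C_level S V i o1 w2)"
proof (rule mono_iff_le_Suc[THEN iffD2], rule allI)
  fix n show "C_level S V i o1 w2 n \<subseteq> C_level S V i o1 w2 (Suc n)"
  proof (cases n)
    case (Suc k)
    have "C_level S V i o1 w2 (Suc k) \<subseteq> writes S \<times> writes S - Id"
      by (cases k) auto
    then show ?thesis
      unfolding Suc C_level.simps(3) rle_def by blast
  qed simp
qed

lemma C_rel_eq_UN: "C_rel S V i o1 w2 = (\<Union>k. C_level S V i o1 w2 k)"
  unfolding C_rel_def by (rule UN_atLeast_1) simp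

lemma C_rel_subset_writes: "C_rel S V i o1 w2 \<subseteq> writes S \<times> writes S"
  unfolding C_rel_eq_UN
proof (rule UN_least)
  fix k show "C_level S V i o1 w2 k \<subseteq> writes S \<times> writes S"
    by (induction S V i o1 w2 k rule: C_level.induct) auto
qed

lemma C_rel_base:
  assumes "w3 \<in> writes S" "w4 \<in> writes S" "w3 \<noteq> w4" "proc S w4 = i"
    "rle (A_rel S V i) o1 w4" "rle (A_rel S V i) w3 w2"
  shows "(w3, w4) \<in> C_rel S V i o1 w2"
proof -
  have "(w3, w4) \<in> C_level S V i o1 w2 (Suc 0)" using assms by simp
  then show ?thesis unfolding C_rel_eq_UN by blast
qed

text \<open>The recursive clause passes to the union of the levels, because the path needs only one
  level of the chain.\<close>

lemma C_rel_step:
  assumes "w3 \<in> writes S" "w4 \<in> writes S" "w3 \<noteq> w4"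
    and C: "(w5, w6) \<in> C_rel S V i o1 w2"
    and "(w3, w5) \<in> (A_rel S V (proc S w4) \<union> C_rel S V i o1 w2)\<^sup>*"
    and "rle (A_rel S V (proc S w4)) w6 w4"
  shows "(w3, w4) \<in> C_rel S V i o1 w2"
proof -
  let ?C = "C_level S V i o1 w2" and ?A = "A_rel S V (proc S w4)"
  obtain k where k: "(w3, w5) \<in> (?A \<union> ?C k)\<^sup>*"
    using rtrancl_Un_chain[OF mono_C_level assms(5)[unfolded C_rel_eq_UN]] by blast
  obtain l where l: "(w5, w6) \<in> ?C l" using C unfolding C_rel_eq_UN by blast
  define n where "n = max k l"
  \<comment> \<open>The index is shifted to \<open>Suc n\<close> because the recursive clause starts
    from a level of this form, never from the dummy level 0.\<close>
  have "?C k \<subseteq> ?C (Suc n)" "?C l \<subseteq> ?C (Suc n)"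
    by (rule monoD[OF mono_C_level]; simp add: n_def)+
  then have "(w3, w5) \<in> (?A \<union> ?C (Suc n))\<^sup>*" "(w5, w6) \<in> ?C (Suc n)"
    using k l rtrancl_mono[of "?A \<union> ?C k" "?A \<union> ?C (Suc n)"] by blast+
  then have "(w3, w4) \<in> ?C (Suc (Suc n))"
    using assms C_rel_subset_writes[of S V i o1 w2]
    by (auto simp: tjoin_def rle_trancl_iff simp del: C_level.simps(2))
  then show ?thesis unfolding C_rel_eq_UN by blast
qed

text \<open>At level 1 the target itself serves as \<open>b\<close>. Each later level extends the
  target by a step \<open>w6\<close> to \<open>w4\<close> in the order of the process of
  \<open>w4\<close>, which is a step of \<open>SWO\<close>.\<close>

lemma C_rel_target:
  assumes "(w3, w4) \<in> C_rel S V i o1 w2"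
  obtains b where "proc S b = i" "rle (A_rel S V i) o1 b" "rle (SWO S V) b w4"
proof -
  obtain k where "(w3, w4) \<in> C_level S V i o1 w2 k" using assms unfolding C_rel_eq_UN by blast
  then have "\<exists>b. proc S b = i \<and> rle (A_rel S V i) o1 b \<and> rle (SWO S V) b w4"
  proof (induction k arbitrary: w3 w4)
    case (Suc k)
    show ?case
    proof (cases k)
      case 0
      then show ?thesis using Suc.prems by (auto simp: rle_def)
    next
      case (Suc n)
      then obtain w5 w6 where w: "w4 \<in> writes S" "w6 \<in> writes S" "(w5, w6) \<in> C_level S V i o1 w2 k"
          "rle (A_rel S V (proc S w4)) w6 w4"
        using Suc.prems by (auto simp del: C_level.simps(2))
      then have "rle (SWO S V) w6 w4" by (auto simp: rle_def SWO_iff)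
      then show ?thesis
        using Suc.IH[OF w(3)] transD[OF trans_SWO[of S V]] unfolding rle_def by metis
    qed
  qed simp
  then show thesis using that by blast
qed


section \<open>Reversing an unrecorded pair\<close>

context
  fixes S :: "('p, 'x, 'o, 'v) memsys" and V :: "'p \<Rightarrow> 'o rel" and i :: 'p and o1 o2 :: 'o
  assumes S: "memory_system S" and V: "explains_scc_execution S V" and i: "i \<in> procs S"
    and o12: "(o1, o2) \<in> DRO S (V i)" "(o1, o2) \<notin> PO S" "(o1, o2) \<notin> SWO_other S V i"
    and cover: "\<not> (\<exists>c. (o1, c) \<in> A_rel S V i \<and> (c, o2) \<in> A_rel S V i)"
begin

section \<open>The covering pair inside \<open>A_rel S V i\<close>\<close>

lemma view_strict_total_order: "m \<in> procs S \<Longrightarrow> strict_total_order (view_dom S m) (V m)"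
  using V by (auto simp: explains_scc_execution_def explains_def is_view_def)

lemma A_rel_subset_dom:
  assumes "m \<in> procs S"
  shows "A_rel S V m \<subseteq> view_dom S m \<times> view_dom S m"
  using A_rel_subset_view[OF S V assms] view_strict_total_order[OF assms]
  by (auto simp: strict_total_order_def)

lemma irrefl_A_rel:
  assumes "m \<in> procs S"
  shows "irrefl (A_rel S V m)"
  using A_rel_subset_view[OF S V assms] view_strict_total_order[OF assms]
  by (auto simp: strict_total_order_def strict_linear_order_on_def irrefl_def)

lemma pair_in_A_rel: "(o1, o2) \<in> A_rel S V i"
  using o12(1) DRO_subset_A_rel[of S V i] by blast

lemma pair_in_dom: "o1 \<in> view_dom S i" "o2 \<in> view_dom S i"
  using A_rel_subset_dom[OF i] pair_in_A_rel by auto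

lemma no_other_path: "(o1, o2) \<notin> (A_rel S V i - {(o1, o2)})\<^sup>*"
  by (rule cover_no_other_path[OF trans_A_rel irrefl_A_rel[OF i] pair_in_A_rel cover])

lemma pair_between:
  assumes "rle (A_rel S V i) o1 c" "rle (A_rel S V i) c o2"
  shows "c = o1 \<or> c = o2"
  using assms cover by (auto simp: rle_def)

lemma rtrancl_removed_imp_rle:
  assumes "(x, y) \<in> (A_rel S V i - {(o1, o2)})\<^sup>*"
  shows "rle (A_rel S V i) x y"
  using assms rtrancl_mono[of "A_rel S V i - {(o1, o2)}" "A_rel S V i"]
  unfolding rle_iff_rtrancl[OF trans_A_rel] by blast

text \<open>Without the pair in \<open>R i\<close>, the modified orders would extend to a valid
  replay with \<open>o2\<close> before \<open>o1\<close>. \<open>C\<close> is a parameter because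
  own and foreign targets need different choices; \<open>closed\<close> and \<open>closed_i\<close>
  ensure that the modified orders force no write pair outside \<open>SWO S V\<close> and
  \<open>C\<close>.\<close>

lemma pair_recorded_by_reversal:
  assumes R: "good_record S V R"
    and C: "C \<subseteq> writes S \<times> writes S"
    and acyc: "\<And>m. m \<in> procs S \<Longrightarrow> m \<noteq> i \<Longrightarrow> acyclic (A_rel S V m \<union> C)"
    and acyc_i: "acyclic (insert (o2, o1) (A_rel S V i - {(o1, o2)} \<union> C))"
    and closed: "\<And>w1 w2. w1 \<in> writes S \<Longrightarrow> w2 \<in> writes S \<Longrightarrow> proc S w2 \<noteq> i \<Longrightarrow>
      (w1, w2) \<in> (A_rel S V (proc S w2) \<union> C)\<^sup>+ \<Longrightarrow> (w1, w2) \<in> SWO S V \<union> C"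
    and closed_i: "\<And>w1 w2. w1 \<in> writes S \<Longrightarrow> w2 \<in> writes S \<Longrightarrow> proc S w2 = i \<Longrightarrow>
      (w1, w2) \<in> (insert (o2, o1) (A_rel S V i - {(o1, o2)} \<union> C))\<^sup>+ \<Longrightarrow> (w1, w2) \<in> SWO S V \<union> C"
  shows "(o1, o2) \<in> R i"
proof (rule ccontr)
  assume nR: "(o1, o2) \<notin> R i"
  define G where "G j = (if j = i then insert (o2, o1) (A_rel S V i - {(o1, o2)} \<union> C)
    else A_rel S V j \<union> C)" for j
  have sub: "A_rel S V j - {(o1, o2)} \<union> C \<subseteq> G j" "j \<noteq> i \<Longrightarrow> A_rel S V j \<subseteq> G j" for j
    by (auto simp: G_def)
  have R_DRO: "R j \<subseteq> DRO S (V j)" if "j \<in> procs S" for j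
    using R that by (auto simp: good_record_def is_record_def)
  obtain V' where V': "explains_scc_execution S V'" "\<And>j. j \<in> procs S \<Longrightarrow> (G j)\<^sup>+ \<subseteq> V' j"
  proof (rule replay_of_closed_orders[OF S, of "\<lambda>j. (G j)\<^sup>+"])
    fix j assume j: "j \<in> procs S"
    have "writes S \<subseteq> view_dom S j" by (auto simp: view_dom_def)
    then have "G j \<subseteq> view_dom S j \<times> view_dom S j"
      using A_rel_subset_dom[OF j] C pair_in_dom by (auto simp: G_def split: if_splits)
    then show "(G j)\<^sup>+ \<subseteq> view_dom S j \<times> view_dom S j"
      by (rule trancl_subset_Sigma)
    show "irrefl ((G j)\<^sup>+)"
      using acyc[OF j] acyc_i by (auto simp: G_def acyclic_irrefl)
    \<comment> \<open>Program order survives the removal, since the removed pair is not in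
      \<open>PO S\<close>.\<close>
    have "Restr (PO S) (view_dom S j) \<subseteq> G j"
      using o12(2) PO_subset_A_rel[of S j V] sub(1)[of j] by blast
    then show "Restr (PO S) (view_dom S j) \<subseteq> (G j)\<^sup>+"
      by (rule order_trans) auto
  next
    show "SCO S (\<lambda>j. (G j)\<^sup>+) \<subseteq> (\<Inter>j \<in> procs S. (G j)\<^sup>+)"
    proof (intro subrelI INT_I)
      fix w1 w2 j assume w: "(w1, w2) \<in> SCO S (\<lambda>j. (G j)\<^sup>+)"
      show "(w1, w2) \<in> (G j)\<^sup>+"
      proof (cases "proc S w2 = j")
        case True
        then show ?thesis using w by (simp add: SCO_def)
      next
        case False
        have "(w1, w2) \<in> SWO S V \<union> C"
          using w closed[of w1 w2] closed_i[of w1 w2]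
          by (cases "proc S w2 = i") (auto simp: SCO_def G_def)
        \<comment> \<open>For \<open>j = i\<close> the pair must differ from the removed one. Its
          target is foreign to \<open>i\<close>, so it lies in \<open>SWO_other S V i\<close>, which
          does not contain \<open>(o1, o2)\<close>.\<close>
        moreover have "(w1, w2) \<in> SWO_other S V i" if "(w1, w2) \<in> SWO S V" "j = i"
          using that False by (auto simp: SWO_other_def)
        ultimately have "(w1, w2) \<in> G j"
          using SWO_subset_A_rel[of S V j] o12(3) by (auto simp: G_def)
        then show ?thesis by auto
      qed
    qed
  qed (auto intro: that)
  \<comment> \<open>The only data-race pair lost is \<open>(o1, o2)\<close>, lost for
    \<open>i\<close> only, and by assumption it is not recorded there.\<close>
  have "R j \<subseteq> G j" if "j \<in> procs S" for j
    using R_DRO[OF that] DRO_subset_A_rel[of S V j] nR sub[of j] by (cases "j = i") blast+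
  then have "R j \<subseteq> V' j" if "j \<in> procs S" for j
  proof (rule order_trans)
    show "G j \<subseteq> V' j" by (rule order_trans[OF _ V'(2)[OF that]]) auto
  qed (rule that)
  then have "certifies_replay S V' R"
    unfolding certifies_replay_def using V'(1) by blast
  then have eq: "DRO S (V' i) = DRO S (V i)"
    using R i by (simp add: good_record_def)
  have "(o2, o1) \<in> V' i" using V'(2)[OF i] by (auto simp: G_def)
  then have "(o2, o1) \<in> DRO S (V' i)" using o12(1) by (auto simp: DRO_def)
  then have "(o2, o1) \<in> A_rel S V i" using eq DRO_subset_A_rel[of S V i] by blast
  then show False
    using transD[OF trans_A_rel pair_in_A_rel] irrefl_A_rel[OF i] by (auto simp: irrefl_def)
qed

text \<open>A path using the reversed pair reaches \<open>w2\<close> from \<open>o1\<close>. Program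
  order compares \<open>w2\<close> with \<open>o2\<close>, and \<open>w2\<close> cannot come first
  without lying between \<open>o1\<close> and \<open>o2\<close>. So \<open>w2\<close> follows
  \<open>o2\<close>, and the path yields only a pair already in \<open>A_rel S V i\<close>.\<close>

lemma own_target_recorded:
  assumes R: "good_record S V R" and own: "proc S o2 = i"
  shows "(o1, o2) \<in> R i"
proof (rule pair_recorded_by_reversal[OF R, of "{}"])
  have o2: "o2 \<in> proc_ops S i"
    using own pair_in_dom(2) by (auto simp: view_dom_def proc_ops_def writes_def)
  have po: "total_on (proc_ops S i) (po S i)" "po S i \<subseteq> PO S"
    using S i by (auto simp: memory_system_def strict_total_order_def strict_linear_order_on_def PO_def)
  have po_A: "(a, b) \<in> A_rel S V i" if "(a, b) \<in> po S i" "a \<in> proc_ops S i" "b \<in> proc_ops S i" for a b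
    using that po(2) PO_subset_A_rel[of S i V] by (auto simp: view_dom_def)
  have asym: "(b, a) \<notin> A_rel S V i" if "(a, b) \<in> A_rel S V i" for a b
    using that transD[OF trans_A_rel] irrefl_A_rel[OF i] by (meson irrefl_def)
  \<comment> \<open>Otherwise program order would relate \<open>o1\<close> and \<open>o2\<close>;
    one direction is excluded by assumption, the other by asymmetry of
    \<open>A_rel S V i\<close>.\<close>
  have o1: "o1 \<notin> proc_ops S i"
  proof
    assume "o1 \<in> proc_ops S i"
    moreover have "o1 \<noteq> o2" using pair_in_A_rel irrefl_A_rel[OF i] by (auto simp: irrefl_def)
    ultimately have "(o2, o1) \<in> po S i"
      using o2 po o12(2) by (auto simp: total_on_def)
    then show False using po_A asym[OF pair_in_A_rel] o2 \<open>o1 \<in> proc_ops S i\<close> by blast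
  qed
  show "acyclic (A_rel S V m \<union> {})" if "m \<in> procs S" for m
    using irrefl_A_rel[OF that] by (simp add: acyclic_irrefl trancl_id[OF trans_A_rel])
  have "acyclic (A_rel S V i - {(o1, o2)})"
    by (rule acyclic_subset[of "A_rel S V i"])
      (use irrefl_A_rel[OF i] in \<open>auto simp: acyclic_irrefl trancl_id[OF trans_A_rel]\<close>)
  then show "acyclic (insert (o2, o1) (A_rel S V i - {(o1, o2)} \<union> {}))"
    using no_other_path by (simp add: acyclic_insert)
  fix w1 w2 assume w: "w1 \<in> writes S" "w2 \<in> writes S"
  show "(w1, w2) \<in> SWO S V \<union> {}" if "(w1, w2) \<in> (A_rel S V (proc S w2) \<union> {})\<^sup>+"
    using that w by (simp add: SWO_iff trancl_id[OF trans_A_rel])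
  assume w2: "proc S w2 = i"
    and path: "(w1, w2) \<in> (insert (o2, o1) (A_rel S V i - {(o1, o2)} \<union> {}))\<^sup>+"
  have w2': "w2 \<in> proc_ops S i" using w w2 by (auto simp: proc_ops_def writes_def)
  let ?A = "A_rel S V i - {(o1, o2)}"
  consider "(w1, w2) \<in> ?A\<^sup>+" | "(w1, o2) \<in> ?A\<^sup>*" "(o1, w2) \<in> ?A\<^sup>*"
    using path by (auto simp: trancl_insert)
  then have "(w1, w2) \<in> A_rel S V i"
  proof cases
    case 1
    then have "(w1, w2) \<in> (A_rel S V i)\<^sup>+" using trancl_mono_subset[of ?A "A_rel S V i"] by auto
    then show ?thesis by (simp add: trancl_id[OF trans_A_rel])
  next
    case 2
    have "w2 \<noteq> o2" using 2(2) no_other_path by blast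
    moreover have "(w2, o2) \<notin> A_rel S V i"
      using pair_between[of w2] rtrancl_removed_imp_rle[OF 2(2)] o1 w2' \<open>w2 \<noteq> o2\<close>
      by (auto simp: rle_def)
    ultimately have "(o2, w2) \<in> A_rel S V i"
      using po(1) o2 w2' po_A unfolding total_on_def by blast
    then show ?thesis
      using rtrancl_removed_imp_rle[OF 2(1)] transD[OF trans_A_rel] unfolding rle_def by metis
  qed
  then show "(w1, w2) \<in> SWO S V \<union> {}" using w w2 by (simp add: SWO_iff)
qed auto

text \<open>\<open>C_rel\<close> is built to absorb what the reversal forces: its first clause
  covers paths through the reversed pair, its recursive clause the propagation through other
  processes.\<close>

lemma foreign_target_recorded:
  assumes R: "good_record S V R" and foreign: "proc S o2 \<noteq> i"
    and acyc: "\<And>m. m \<in> procs S \<Longrightarrow> m \<noteq> i \<Longrightarrow> acyclic (A_rel S V m \<union> C_rel S V i o1 o2)"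
    and acyc_i: "acyclic (A_rel S V i - {(o1, o2)} \<union> C_rel S V i o1 o2)"
  shows "(o1, o2) \<in> R i"
proof (rule pair_recorded_by_reversal[OF R, of "C_rel S V i o1 o2"])
  let ?C = "C_rel S V i o1 o2" and ?A = "A_rel S V i - {(o1, o2)}"
  show "?C \<subseteq> writes S \<times> writes S" by (rule C_rel_subset_writes)
  show "acyclic (A_rel S V m \<union> ?C)" if "m \<in> procs S" "m \<noteq> i" for m
    by (rule acyc[OF that])
  have rle_trans: "rle (A_rel S V i) a c" if "rle (A_rel S V i) a b" "rle (A_rel S V i) b c" for a b c
    using that transD[OF trans_A_rel] unfolding rle_def by metis
  have target: "rle (A_rel S V i) o1 w4" if C: "(w3, w4) \<in> ?C" for w3 w4
  proof -
    obtain b where b: "rle (A_rel S V i) o1 b" "rle (SWO S V) b w4"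
      using C_rel_target[OF C] by blast
    have "rle (A_rel S V i) b w4" using b(2) SWO_subset_A_rel[of S V i] unfolding rle_def by blast
    with b(1) show ?thesis by (rule rle_trans)
  qed
  \<comment> \<open>This makes it safe to add the reversed pair. The target \<open>v\<close> of the
    last \<open>C\<close> step lies between \<open>o1\<close> and \<open>o2\<close>, hence equals
    one of them; \<open>v = o1\<close> closes a cycle excluded by \<open>acyc_i\<close>.\<close>
  have "(o1, o2) \<notin> (?A \<union> ?C)\<^sup>*"
  proof
    assume "(o1, o2) \<in> (?A \<union> ?C)\<^sup>*"
    then show False
    proof (cases rule: rtrancl_Un_last)
      case 1
      then show ?thesis using no_other_path by blast
    next
      case (2 u v)
      have v: "v = o1 \<or> v = o2"
        by (rule pair_between[OF target[OF 2(2)] rtrancl_removed_imp_rle[OF 2(3)]])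
      show False
      proof (cases "v = o1")
        case True
        then have "(o1, o1) \<in> (?A \<union> ?C)\<^sup>+" using 2(1,2) by (meson UnI2 rtrancl_into_trancl1)
        then show False using acyc_i by (auto simp: acyclic_def)
      next
        case False
        then have "v = o2" using v by blast
        \<comment> \<open>This \<open>b\<close> belongs to \<open>i\<close>, so it is not
          \<open>o2\<close>. Covering forces \<open>b = o1\<close>, which would put the pair into
          \<open>SWO_other S V i\<close>.\<close>
        then obtain b where b: "proc S b = i" "rle (A_rel S V i) o1 b" "rle (SWO S V) b o2"
          using C_rel_target[OF 2(2)] by blast
        have "b \<noteq> o2" using b(1) foreign by blast
        then have bo: "(b, o2) \<in> SWO S V" using b(3) by (auto simp: rle_def)
        then have "(b, o2) \<in> A_rel S V i" using SWO_subset_A_rel[of S V i] by blast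
        then have "b = o1" using pair_between[OF b(2)] \<open>b \<noteq> o2\<close> by (auto simp: rle_def)
        then have "(o1, o2) \<in> SWO_other S V i" using bo foreign by (auto simp: SWO_other_def)
        then show False using o12(3) by blast
      qed
    qed
  qed
  with acyc_i show acyc': "acyclic (insert (o2, o1) (?A \<union> ?C))" by (simp add: acyclic_insert)
  have AC: "(?A \<union> ?C)\<^sup>* \<subseteq> (A_rel S V i \<union> ?C)\<^sup>*" by (rule rtrancl_mono) auto
  have extend: "(w1, w2) \<in> SWO S V \<union> ?C"
    if w: "w1 \<in> writes S" "w2 \<in> writes S" "w1 \<noteq> w2" and
      path: "(w1, w2) \<in> (A_rel S V (proc S w2) \<union> ?C)\<^sup>*" for w1 w2
    using path
  proof (cases rule: rtrancl_Un_last)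
    case 1
    then have "rle (A_rel S V (proc S w2)) w1 w2" by (simp add: rle_iff_rtrancl[OF trans_A_rel])
    then show ?thesis using w by (auto simp: rle_def SWO_iff)
  next
    case (2 u v)
    then have "(w1, w2) \<in> ?C"
      using C_rel_step[OF w 2(2,1)] by (simp add: rle_iff_rtrancl[OF trans_A_rel])
    then show ?thesis by blast
  qed
  fix w1 w2 assume w: "w1 \<in> writes S" "w2 \<in> writes S"
  show "(w1, w2) \<in> SWO S V \<union> ?C" if "proc S w2 \<noteq> i" "(w1, w2) \<in> (A_rel S V (proc S w2) \<union> ?C)\<^sup>+"
  proof (rule extend[OF w])
    have "proc S w2 \<in> procs S" using S w(2) by (auto simp: memory_system_def writes_def)
    then show "w1 \<noteq> w2" using acyc[of "proc S w2"] that by (auto simp: acyclic_def)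
    show "(w1, w2) \<in> (A_rel S V (proc S w2) \<union> ?C)\<^sup>*" using that(2) by (rule trancl_into_rtrancl)
  qed
  assume w2: "proc S w2 = i" and path: "(w1, w2) \<in> (insert (o2, o1) (?A \<union> ?C))\<^sup>+"
  have ne: "w1 \<noteq> w2" using acyc' path by (auto simp: acyclic_def)
  consider "(w1, w2) \<in> (?A \<union> ?C)\<^sup>+" | "(w1, o2) \<in> (?A \<union> ?C)\<^sup>*" "(o1, w2) \<in> (?A \<union> ?C)\<^sup>*"
    using path by (auto simp: trancl_insert)
  then show "(w1, w2) \<in> SWO S V \<union> ?C"
  proof cases
    case 1
    then have "(w1, w2) \<in> (A_rel S V (proc S w2) \<union> ?C)\<^sup>*"
      using AC w2 by (meson subsetD trancl_into_rtrancl)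
    then show ?thesis by (rule extend[OF w ne])
  next
    case 2
    \<comment> \<open>Targets of \<open>C\<close> already lie above \<open>o1\<close>, so only the
      tail after the last \<open>C\<close> step matters.\<close>
    from 2(2) have o1_w2: "rle (A_rel S V i) o1 w2"
    proof (cases rule: rtrancl_Un_last)
      case 1
      then show ?thesis by (rule rtrancl_removed_imp_rle)
    next
      case (2 u v)
      show ?thesis by (rule rle_trans[OF target[OF 2(2)] rtrancl_removed_imp_rle[OF 2(3)]])
    qed
    from 2(1) show ?thesis
    proof (cases rule: rtrancl_Un_last)
      case 1
      \<comment> \<open>With \<open>w1\<close> below \<open>o2\<close> and \<open>w2\<close> above
        \<open>o1\<close>, the first clause of \<open>C_rel\<close> applies.\<close>
      then show ?thesis
        by (intro UnI2 C_rel_base[OF w ne w2 o1_w2] rtrancl_removed_imp_rle)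
    next
      case (2 u v)
      have v: "v \<in> writes S" using 2(2) C_rel_subset_writes[of S V i o1 o2] by blast
      have v_o2: "rle (A_rel S V i) v o2" by (rule rtrancl_removed_imp_rle[OF 2(3)])
      \<comment> \<open>The clauses of \<open>C_rel\<close> relate distinct writes only. Equality
        would give a path from \<open>o1\<close> to \<open>o2\<close>, closed to a cycle by the
        reversed pair. Then \<open>(v, w2)\<close> is a base pair, and the path from
        \<open>w1\<close> to \<open>v\<close> extends it.\<close>
      have "v \<noteq> w2"
      proof
        assume "v = w2"
        then have "(w2, o2) \<in> (?A \<union> ?C)\<^sup>*"
          using 2(3) rtrancl_mono[of ?A "?A \<union> ?C"] by blast
        with \<open>(o1, w2) \<in> (?A \<union> ?C)\<^sup>*\<close> show False
          using acyc' by (meson acyclic_insert rtrancl_trans)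
      qed
      then have "(v, w2) \<in> ?C" by (rule C_rel_base[OF v w(2) _ w2 o1_w2 v_o2])
      moreover have "(w1, v) \<in> (A_rel S V (proc S w2) \<union> ?C)\<^sup>*"
        using 2(1,2) AC w2 by (meson UnI2 rtrancl.rtrancl_into_rtrancl subsetD)
      ultimately show ?thesis
        using C_rel_step[OF w ne, of v w2] by (auto simp: rle_def)
    qed
  qed
qed

end

theorem theorem6p7:
  fixes S :: "('p, 'x, 'o, 'v) memsys"
    and V R :: "'p \<Rightarrow> 'o rel"
    and i :: 'p and o1 o2 :: 'o
  assumes "memory_system S"
    and "explains_scc_execution S V"
    and "good_record S V R"
    and "i \<in> procs S"
    and "o1 \<in> view_dom S i" and "o2 \<in> view_dom S i"
    and "(o1, o2) \<in> transitive_reduction (A_rel S V i)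
                     - (PO S \<union> SWO_other S V i \<union> B_rel S V i)"
  shows "(o1, o2) \<in> R i"
proof -
  have "strict_total_order (view_dom S i) (V i)"
    using assms(2,4) by (auto simp: explains_scc_execution_def explains_def is_view_def)
  then have st: "A_rel S V i \<subseteq> view_dom S i \<times> view_dom S i" "irrefl (A_rel S V i)"
    using A_rel_subset_view[OF assms(1,2,4)]
    by (auto simp: strict_total_order_def strict_linear_order_on_def irrefl_def)
  have "finite (A_rel S V i)"
    using st(1) finite_view_dom[OF assms(1)] by (meson finite_SigmaI finite_subset)
  then have cov: "(o1, o2) \<in> A_rel S V i" "\<not> (\<exists>c. (o1, c) \<in> A_rel S V i \<and> (c, o2) \<in> A_rel S V i)"
    and n: "(o1, o2) \<notin> PO S" "(o1, o2) \<notin> SWO_other S V i" "(o1, o2) \<notin> B_rel S V i"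
    using assms(7) by (auto simp: transitive_reduction_eq_cover[OF _ trans_A_rel st(2)])
  \<comment> \<open>A covering pair belongs to every generating set of the order, and two of the
    three kinds of generators are excluded.\<close>
  have "(o1, o2) \<in> DRO S (V i) \<union> SWO_other S V i \<union> Restr (PO S) (view_dom S i)"
    by (rule subsetD[OF cover_least[OF A_rel_eq[symmetric]]]) (use cov in simp)
  then have dro: "(o1, o2) \<in> DRO S (V i)" using n by blast
  note ctx = assms(1,2,4) dro n(1,2) cov(2) assms(3)
  show ?thesis
  proof (cases "proc S o2 = i")
    case True
    then show ?thesis by (rule own_target_recorded[OF ctx])
  next
    case False
    \<comment> \<open>A foreign operation in the view domain is a write. With the remaining side
      conditions of \<open>B_rel\<close> met, being outside \<open>B_rel\<close> means that the
      cycle condition fails.\<close>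
    then have "o2 \<in> writes S" using assms(6) by (auto simp: view_dom_def proc_ops_def)
    moreover have "o1 \<in> ops S" "var S o1 = var S o2" using dro by (auto simp: DRO_def var_ops_def)
    ultimately have "\<not> (\<exists>m \<in> procs S.
        (m \<noteq> i \<and> \<not> acyclic (A_rel S V m \<union> C_rel S V i o1 o2)) \<or>
        (m = i \<and> \<not> acyclic (A_rel S V i - {(o1, o2)} \<union> C_rel S V i o1 o2)))"
      using n(3) dro by (simp add: B_rel_def)
    then have "acyclic (A_rel S V i - {(o1, o2)} \<union> C_rel S V i o1 o2)"
      and "\<And>m. m \<in> procs S \<Longrightarrow> m \<noteq> i \<Longrightarrow> acyclic (A_rel S V m \<union> C_rel S V i o1 o2)"
      using assms(4) by metis+
    then show ?thesis by (intro foreign_target_recorded[OF ctx False])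
  qed
qed

end
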